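(* Consider a perfect fluid with energy density $\mu$ and pressure $p$ obeying an equation of state $f(\mu,p)=0$, where $f$ is an analytic function of $(\mu,p)$ at the central values $(\mu_c,p_c)=(\mu(0),p(0))$ and $\partial_\mu f(\mu_c,p_c)\neq 0$. Suppose that $\mu(r)$, $p(r)$ are real analytic at $r=0$ and solve the Tolman--Oppenheimer--Volkoff (TOV) equations together with the equation of state $f(\mu(r),p(r))=0$, for a compact stellar object (i.e. $r>2M(r)$ for $r>0$). Then $\mu$ is an even function of the circumferential radius coordinate $r$: its power series about $r=0$ contains only even powers of $r$.
   Context: Units $8\pi G=c=1$, cosmological constant $\Lambda=0$. The TOV equations for functions $\mu(r)$ (energy density) and $p(r)$ (pressure) of the circumferential radius $r$ are $$\frac{dp}{dr}=-\frac{r^{2}(\mu+p)}{2(r-2M)}\left(p+\frac{2M}{r^{3}}\right),\qquad \frac{dM}{dr}=\frac12\mu r^{2},\qquad M(r)=\frac12\int_0^r\mu(x)x^2\,dx .$$ Only regular solutions with $r>2M(r)$ (called stars, or compact stellar objects) are considered. "Real analytic at $r=0$" means given near $r=0$ by a convergent power series in $r$ with real coefficients. *)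

theory Defs
  imports "HOL-Analysis.Analysis"
begin

(* Real analyticity of a function of two real variables: near (x0, y0) it is the sum of a
   double power series. For real-valued families has_sum is unconditional, hence absolute,
   convergence. *)
definition real_analytic2_at :: "(real \<Rightarrow> real \<Rightarrow> real) \<Rightarrow> real \<Rightarrow> real \<Rightarrow> bool" where
  "real_analytic2_at f x0 y0 \<longleftrightarrow>
     (\<exists>c :: nat \<Rightarrow> nat \<Rightarrow> real. \<exists>e>0. \<forall>x y. \<bar>x - x0\<bar> < e \<longrightarrow> \<bar>y - y0\<bar> < e \<longrightarrow>
        ((\<lambda>(i, j). c i j * (x - x0) ^ i * (y - y0) ^ j) has_sum f x y) UNIV)"

(* The TOV equations in units 8 pi G = c = 1 with vanishing cosmological constant, on the ball
   of circumferential radius R. They are singular at r = 0 and are imposed for 0 < r < R only.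
   The last conjunct (no horizon, r > 2M) is what makes the solution a star. *)
definition TOV_star ::
    "real \<Rightarrow> (real \<Rightarrow> real) \<Rightarrow> (real \<Rightarrow> real) \<Rightarrow> (real \<Rightarrow> real) \<Rightarrow> bool" where
  "TOV_star R \<mu> p M \<longleftrightarrow>
     (\<forall>r. 0 \<le> r \<and> r < R \<longrightarrow>
        (\<lambda>x. \<mu> x * x\<^sup>2) integrable_on {0..r} \<and>
        M r = 1 / 2 * integral {0..r} (\<lambda>x. \<mu> x * x\<^sup>2)) \<and>
     (\<forall>r. 0 < r \<and> r < R \<longrightarrow>
        (p has_real_derivative
           - (r\<^sup>2 * (\<mu> r + p r)) / (2 * (r - 2 * M r)) * (p r + 2 * M r / r ^ 3)) (at r) \<and>
        (M has_real_derivative 1 / 2 * \<mu> r * r\<^sup>2) (at r) \<and>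
        r > 2 * M r)"

end

theory Submission
  imports Defs "HOL-Complex_Analysis.Laurent_Convergence"
begin

text \<open>
  Writing \<open>2 M(r) = r\<^sup>3 K(r)\<close>, the TOV equation becomes the regular identity
  \<open>2 (1 - r\<^sup>2 K) p' = - r (\<mu> + p) (p + K)\<close> between power series, which preserves parity. Hence, for
  odd \<open>n\<close>, if the odd coefficients of \<open>\<mu>\<close> and \<open>p\<close> below \<open>n\<close> vanish, so does the \<open>n\<close>-th coefficient
  of \<open>p\<close>. The \<open>n\<close>-th coefficient of \<open>f(\<mu>(r), p(r)) = 0\<close> then reduces to
  \<open>\<partial>\<^sub>\<mu>f \<cdot> \<mu>\<^sub>n = 0\<close>, since every other monomial of \<open>f\<close> contributes products in which one factor
  is an odd coefficient of order below \<open>n\<close> (or \<open>p\<^sub>n\<close> itself). Truncating \<open>f\<close> at total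
  degree \<open>n\<close> with an \<open>O(r\<^sup>n\<^sup>+\<^sup>1)\<close> remainder as \<open>r \<rightarrow> 0+\<close> makes the implicit function theorem and
  the composition of analytic functions unnecessary.
\<close>

section \<open>Coefficients of power series from one-sided asymptotics at 0\<close>

text \<open>Once the coefficients below \<open>k\<close> vanish, \<open>g x / x ^ k\<close> tends to
  the \<open>k\<close>-th one, while the bound sends this quotient to 0 because
  \<open>k < N\<close>. The limit is taken from the right since the stellar equations are given on
  that side only.\<close>

lemma fps_nth_eq_0_if_bigo_at_right:
  fixes g :: "real \<Rightarrow> real"
  assumes g: "g has_fps_expansion H" and bigo: "g \<in> O[at_right 0](\<lambda>r. r ^ N)" and "k < N"
  shows "fps_nth H k = 0"
  using \<open>k < N\<close>
proof (induction k rule: less_induct)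
  case (less k)
  show ?case
  proof (cases "H = 0")
    case False
    with less have "k \<le> subdegree H"
      by (intro subdegree_geI) auto
    \<comment> \<open>Filling in the coefficient as the value at 0 makes the quotient continuous
      there.\<close>
    then have "(\<lambda>x. if x = 0 then fps_nth H k else g x / x ^ k) has_fps_expansion fps_shift k H"
      by (intro has_fps_expansion_shift g) auto
    from has_fps_expansion_imp_continuous[OF this, of UNIV]
    have "((\<lambda>x. if x = 0 then fps_nth H k else g x / x ^ k) \<longlongrightarrow> fps_nth H k) (at 0)"
      by (simp add: isCont_def)
    then have "((\<lambda>x. if x = 0 then fps_nth H k else g x / x ^ k) \<longlongrightarrow> fps_nth H k) (at_right 0)"
      by (rule tendsto_mono[rotated]) (simp add: at_le)
    then have 1: "((\<lambda>x. g x / x ^ k) \<longlongrightarrow> fps_nth H k) (at_right 0)"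
      by (rule Lim_transform_eventually) (auto simp: eventually_at_filter)
    have "\<forall>\<^sub>F x in at_right (0::real). x \<noteq> 0"
      by (simp add: eventually_at_filter)
    then have "\<forall>\<^sub>F x in at_right (0::real). x ^ k \<noteq> 0"
      by eventually_elim simp
    then have "(\<lambda>x. g x / x ^ k) \<in> O[at_right 0](\<lambda>x. x ^ N / x ^ k)"
      by (intro landau_o.big.divide_right bigo)
    also have "(\<lambda>x. x ^ N / x ^ k) \<in> \<Theta>[at_right 0](\<lambda>x. x ^ (N - k))"
      using less.prems by (intro bigthetaI_cong) (auto simp: eventually_at_filter power_diff)
    also have "(\<lambda>x::real. x ^ (N - k)) \<in> o[at_right 0](\<lambda>_. 1)"
    proof (rule smalloI_tendsto)
      have "((\<lambda>x::real. x ^ (N - k)) \<longlongrightarrow> 0 ^ (N - k)) (at_right 0)"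
        by (intro tendsto_intros)
      with less.prems show "((\<lambda>x::real. x ^ (N - k) / 1) \<longlongrightarrow> 0) (at_right 0)"
        by (simp add: power_0_left)
    qed auto
    finally have "((\<lambda>x. g x / x ^ k) \<longlongrightarrow> 0) (at_right 0)"
      by (auto dest: smalloD_tendsto)
    with 1 show ?thesis
      by (rule tendsto_unique[rotated]) simp
  qed auto
qed

text \<open>Used to turn a differential equation valid for small positive radii into an identity of
  formal power series.\<close>

lemma fps_eq_0_if_eventually_0_at_right:
  fixes g :: "real \<Rightarrow> real"
  assumes "g has_fps_expansion H" and "\<forall>\<^sub>F r in at_right 0. g r = 0"
  shows "H = 0"
proof (rule fps_ext)
  fix n
  have "g \<in> O[at_right 0](\<lambda>r. r ^ Suc n)"
    using assms(2) by (intro bigoI[of _ 0]) simp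
  then show "fps_nth H n = fps_nth 0 n"
    using fps_nth_eq_0_if_bigo_at_right[OF assms(1), of "Suc n" n] by simp
qed

lemma has_fps_expansion_bigo_id:
  fixes g :: "real \<Rightarrow> real"
  assumes "g has_fps_expansion G"
  shows "(\<lambda>x. g x - g 0) \<in> O[at 0](\<lambda>x. x)"
proof -
  from assms have r: "norm (0::real) < fps_conv_radius G" and ev: "\<forall>\<^sub>F x in nhds 0. eval_fps G x = g x"
    by (auto simp: has_fps_expansion_def zero_ereal_def)
  have "(eval_fps G has_field_derivative eval_fps (fps_deriv G) 0) (at 0)"
    by (rule has_field_derivative_eval_fps[OF r])
  then have "(g has_field_derivative eval_fps (fps_deriv G) 0) (at 0)"
    using DERIV_cong_ev[OF refl ev refl] by blast
  then have "((\<lambda>x. (g x - g 0) / x) \<longlongrightarrow> eval_fps (fps_deriv G) 0) (at 0)"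
    by (simp add: has_field_derivative_iff)
  then show ?thesis
    by (intro bigoI_tendsto) (auto simp: eventually_at_filter)
qed

section \<open>Termwise integration\<close>

lemma fps_conv_radius_integral0:
  fixes F :: "real fps"
  shows "fps_conv_radius (fps_integral0 F) \<ge> fps_conv_radius F"
  unfolding fps_conv_radius_def[of "fps_integral0 F"]
proof (rule conv_radius_geI_ex)
  fix r :: real assume r: "r > 0" "ereal r < fps_conv_radius F"
  then have "summable (\<lambda>n. norm (fps_nth F n * r ^ n))"
    by (intro norm_summable_fps) auto
  then have "summable (\<lambda>n. r * norm (fps_nth F n * r ^ n))"
    by (rule summable_mult)
  moreover have "norm (fps_nth (fps_integral0 F) (Suc n) * r ^ Suc n)
      \<le> r * norm (fps_nth F n * r ^ n)" for n
  proof -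
    have "norm (fps_nth (fps_integral0 F) (Suc n) * r ^ Suc n)
        = inverse (real (Suc n)) * (r * norm (fps_nth F n * r ^ n))"
      using r by (simp add: abs_mult mult_ac)
    also have "\<dots> \<le> 1 * (r * norm (fps_nth F n * r ^ n))"
      using r by (intro mult_right_mono) (auto simp: inverse_le_1_iff)
    finally show ?thesis by simp
  qed
  ultimately have "summable (\<lambda>n. fps_nth (fps_integral0 F) (Suc n) * r ^ Suc n)"
    by (rule summable_comparison_test')
  then have "summable (\<lambda>n. fps_nth (fps_integral0 F) n * r ^ n)"
    by (subst (asm) summable_Suc_iff)
  with r show "\<exists>z. norm z = r \<and> summable (\<lambda>n. fps_nth (fps_integral0 F) n * z ^ n)"
    by (intro exI[of _ r]) auto
qed

text \<open>The termwise antiderivative enters the fundamental theorem of calculus. This gives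
  access to the mass, which is defined by an integral, as a power series.\<close>

lemma integral_eq_eval_fps_integral0:
  fixes g :: "real \<Rightarrow> real"
  assumes "g has_fps_expansion G"
  shows "\<forall>\<^sub>F r in at_right 0. integral {0..r} g = eval_fps (fps_integral0 G) r"
proof -
  have "\<forall>\<^sub>F x in nhds 0. x \<in> eball 0 (fps_conv_radius G)"
    using assms by (intro eventually_nhds_in_open) (auto simp: has_fps_expansion_def zero_ereal_def)
  moreover have "\<forall>\<^sub>F x in nhds 0. eval_fps G x = g x"
    using assms by (simp add: has_fps_expansion_def)
  ultimately have "\<forall>\<^sub>F x in nhds 0. ereal \<bar>x\<bar> < fps_conv_radius G \<and> eval_fps G x = g x"
    by eventually_elim auto
  then obtain d where d: "d > 0"
      "\<And>x. \<bar>x\<bar> < d \<Longrightarrow> ereal \<bar>x\<bar> < fps_conv_radius G \<and> eval_fps G x = g x"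
    by (auto simp: eventually_nhds_metric)
  have "integral {0..r} g = eval_fps (fps_integral0 G) r" if r: "0 < r" "r < d" for r
  proof -
    have "(g has_integral eval_fps (fps_integral0 G) r - eval_fps (fps_integral0 G) 0) {0..r}"
    proof (rule fundamental_theorem_of_calculus)
      fix x assume x: "x \<in> {0..r}"
      with r d(2)[of x] have "norm x < fps_conv_radius G"
        by simp
      also have "\<dots> \<le> fps_conv_radius (fps_integral0 G)"
        by (rule fps_conv_radius_integral0)
      finally have "norm x < fps_conv_radius (fps_integral0 G)" .
      then have "(eval_fps (fps_integral0 G) has_field_derivative
          eval_fps (fps_deriv (fps_integral0 G)) x) (at x within {0..r})"
        by (rule has_field_derivative_eval_fps)
      with x r d(2)[of x] show "(eval_fps (fps_integral0 G) has_vector_derivative g x) (at x within {0..r})"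
        by (simp add: fps_deriv_fps_integral has_real_derivative_iff_has_vector_derivative)
    qed (use r in auto)
    then show ?thesis
      by (simp add: eval_fps_at_0 integral_unique)
  qed
  with d(1) show ?thesis
    by (auto simp: eventually_at_right_field)
qed

section \<open>Parity up to a given order\<close>

text \<open>The bound is strict so that, at an odd order \<open>n\<close>, this is exactly the
  induction hypothesis and leaves coefficient \<open>n\<close> open.\<close>

definition even_below :: "nat \<Rightarrow> 'a::zero fps \<Rightarrow> bool" where
  "even_below n A \<longleftrightarrow> (\<forall>k<n. odd k \<longrightarrow> fps_nth A k = 0)"

lemma even_below_add:
  fixes A :: "'a::monoid_add fps"
  shows "even_below n A \<Longrightarrow> even_below n B \<Longrightarrow> even_below n (A + B)"
  by (simp add: even_below_def)

lemma even_below_diff: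
  fixes A :: "'a::group_add fps"
  shows "even_below n A \<Longrightarrow> even_below n B \<Longrightarrow> even_below n (A - B)"
  by (simp add: even_below_def)

lemma even_below_const [simp]: "even_below n (fps_const c)"
  by (auto simp: even_below_def)

text \<open>In a coefficient of odd order \<open>k\<close> the indices \<open>i\<close> and
  \<open>k - i\<close> have opposite parity, so each product contains a vanishing odd
  coefficient.\<close>

lemma even_below_mult:
  fixes A :: "'a::semiring_0 fps"
  assumes "even_below n A" "even_below n B"
  shows "even_below n (A * B)"
  unfolding even_below_def
proof (intro allI impI)
  fix k assume k: "k < n" "odd k"
  have "fps_nth A i * fps_nth B (k - i) = 0" if "i \<in> {0..k}" for i
    using assms k that by (cases "even i") (auto simp: even_below_def)
  then show "fps_nth (A * B) k = 0"
    by (simp add: fps_mult_nth)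
qed

lemma even_below_power:
  fixes A :: "'a::comm_semiring_1 fps"
  assumes "even_below n A"
  shows "even_below n (A ^ i)"
proof (induction i)
  case 0
  then show ?case using even_below_const[of n 1] by simp
qed (use assms in \<open>auto intro: even_below_mult\<close>)

text \<open>Reaches one order further than \<open>even_below_mult\<close>: the unknown
  \<open>n\<close>-th coefficients occur only for \<open>i = 0\<close> and \<open>i = n\<close>,
  where the other factor is a vanishing constant term.\<close>

lemma even_below_mult_nth:
  fixes A :: "'a::semiring_0 fps"
  assumes "even_below n A" "even_below n B" "fps_nth A 0 = 0" "fps_nth B 0 = 0" "odd n"
  shows "fps_nth (A * B) n = 0"
proof -
  have "fps_nth A i * fps_nth B (n - i) = 0" if "i \<in> {0..n}" for i
  proof (cases "i = 0 \<or> i = n")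
    case False
    with assms that show ?thesis
      by (cases "even i") (auto simp: even_below_def)
  qed (use assms in auto)
  then show ?thesis
    by (simp add: fps_mult_nth)
qed

text \<open>A monomial of total degree at least two splits into two factors without constant term.
  The two linear monomials are excluded because they carry the \<open>n\<close>-th coefficients of
  \<open>A\<close> and \<open>B\<close> themselves.\<close>

lemma even_below_monom_nth:
  fixes A :: "'a::comm_semiring_1 fps"
  assumes A: "even_below n A" "fps_nth A 0 = 0" and B: "even_below n B" "fps_nth B 0 = 0"
    and n: "odd n" and ij: "(i, j) \<noteq> (1, 0)" "(i, j) \<noteq> (0, 1)"
  shows "fps_nth (A ^ i * B ^ j) n = 0"
proof -
  consider "i = 0" "j = 0" | i' where "i = Suc i'" "i' > 0 \<or> j > 0"
    | j' where "i = 0" "j = Suc j'" "j' > 0"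
    using ij by (cases i; cases j) auto
  then show ?thesis
  proof cases
    case 1
    with odd_pos[OF n] show ?thesis by simp
  next
    case 2
    then have "fps_nth (A * (A ^ i' * B ^ j)) n = 0"
      using A B n
      by (intro even_below_mult_nth[OF _ _ _ _ n] even_below_mult even_below_power)
        (auto simp: power_0_left fps_nth_power_0)
    with 2 show ?thesis by (simp add: mult.assoc)
  next
    case 3
    then have "fps_nth (B * B ^ j') n = 0"
      using B by (intro even_below_mult_nth[OF _ _ _ _ n] even_below_power)
        (auto simp: power_0_left fps_nth_power_0)
    with 3 show ?thesis by simp
  qed
qed

section \<open>Truncation of double power series by total degree\<close>

definition deg_lt :: "nat \<Rightarrow> (nat \<times> nat) set" where
  "deg_lt N = {(i, j). i + j < N}"

lemma mem_deg_lt [simp]: "(i, j) \<in> deg_lt N \<longleftrightarrow> i + j < N"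
  by (simp add: deg_lt_def)

lemma finite_deg_lt [simp]: "finite (deg_lt N)"
  by (rule finite_subset[of _ "{..N} \<times> {..N}"]) (auto simp: deg_lt_def)

text \<open>For \<open>x\<close> and \<open>y\<close> bounded by \<open>t\<close>, a term of total
  degree at least \<open>N\<close> is in absolute value at most \<open>(t / d) ^ N\<close> times its
  size at \<open>(d, d)\<close>, since \<open>t / d\<close> is at most 1. Absolute summability at
  \<open>(d, d)\<close> then yields the uniform constant \<open>C = S / d ^ N\<close>.\<close>

lemma double_series_remainder_le:
  fixes c :: "nat \<Rightarrow> nat \<Rightarrow> real"
  assumes f: "\<And>x y. \<bar>x\<bar> < e \<Longrightarrow> \<bar>y\<bar> < e \<Longrightarrow>
      ((\<lambda>(i, j). c i j * x ^ i * y ^ j) has_sum f x y) UNIV"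
    and d: "0 < d" "d < e"
  obtains C where "\<And>x y t. \<bar>x\<bar> \<le> t \<Longrightarrow> \<bar>y\<bar> \<le> t \<Longrightarrow> t \<le> d \<Longrightarrow>
    \<bar>f x y - (\<Sum>(i, j)\<in>deg_lt N. c i j * x ^ i * y ^ j)\<bar> \<le> C * t ^ N"
proof
  define S where "S = (\<Sum>\<^sub>\<infinity>(i, j)\<in>-deg_lt N. \<bar>c i j\<bar> * d ^ i * d ^ j)"
  have "(\<lambda>(i, j). c i j * d ^ i * d ^ j) summable_on UNIV"
    using f[of d d] d by (auto simp: summable_on_def)
  then have "(\<lambda>(i, j). c i j * d ^ i * d ^ j) summable_on -deg_lt N"
    by (rule summable_on_subset) auto
  then have "(\<lambda>z. norm ((\<lambda>(i, j). c i j * d ^ i * d ^ j) z)) summable_on -deg_lt N"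
    by (subst (asm) summable_on_iff_abs_summable_on_real)
  also have "(\<lambda>z. norm ((\<lambda>(i, j). c i j * d ^ i * d ^ j) z))
      = (\<lambda>(i, j). \<bar>c i j\<bar> * d ^ i * d ^ j)"
    using d by (auto simp: abs_mult)
  finally have S: "((\<lambda>(i, j). \<bar>c i j\<bar> * d ^ i * d ^ j) has_sum S) (-deg_lt N)"
    unfolding S_def by (rule has_sum_infsum)
  fix x y t :: real
  assume xyt: "\<bar>x\<bar> \<le> t" "\<bar>y\<bar> \<le> t" "t \<le> d"
  have "((\<lambda>(i, j). c i j * x ^ i * y ^ j) has_sum
      (f x y - (\<Sum>(i, j)\<in>deg_lt N. c i j * x ^ i * y ^ j))) (UNIV - deg_lt N)"
    using xyt d by (intro has_sum_Diff f has_sum_finite) auto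
  moreover have "((\<lambda>z. (t / d) ^ N * (case z of (i, j) \<Rightarrow> \<bar>c i j\<bar> * d ^ i * d ^ j))
      has_sum ((t / d) ^ N * S)) (UNIV - deg_lt N)"
    using S by (intro has_sum_cmult_right) (simp add: Compl_eq_Diff_UNIV)
  ultimately have "norm (f x y - (\<Sum>(i, j)\<in>deg_lt N. c i j * x ^ i * y ^ j)) \<le> (t / d) ^ N * S"
  proof (rule norm_infsum_le)
    fix z assume "z \<in> UNIV - deg_lt N"
    then obtain i j where z: "z = (i, j)" "N \<le> i + j"
      by (cases z) (auto simp: deg_lt_def)
    have "\<bar>x\<bar> ^ i * \<bar>y\<bar> ^ j \<le> t ^ i * t ^ j"
      using xyt by (intro mult_mono power_mono) auto
    also have "\<dots> = (t / d) ^ (i + j) * (d ^ i * d ^ j)"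
      using d by (simp add: power_divide power_add)
    also have "\<dots> \<le> (t / d) ^ N * (d ^ i * d ^ j)"
      using xyt d z by (intro mult_right_mono power_decreasing) auto
    finally have "\<bar>c i j\<bar> * (\<bar>x\<bar> ^ i * \<bar>y\<bar> ^ j) \<le> \<bar>c i j\<bar> * ((t / d) ^ N * (d ^ i * d ^ j))"
      by (rule mult_left_mono) auto
    then show "norm (case z of (i, j) \<Rightarrow> c i j * x ^ i * y ^ j)
        \<le> (t / d) ^ N * (case z of (i, j) \<Rightarrow> \<bar>c i j\<bar> * d ^ i * d ^ j)"
      by (simp add: z abs_mult power_abs mult_ac)
  qed
  then show "\<bar>f x y - (\<Sum>(i, j)\<in>deg_lt N. c i j * x ^ i * y ^ j)\<bar> \<le> (S / d ^ N) * t ^ N"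
    by (simp add: power_divide mult_ac)
qed

text \<open>Formulated for a curve \<open>(a, b)\<close> along a filter because it serves twice: on
  the first coordinate axis for the partial derivative, and on the profile of the star as r tends to
  0 from the right.\<close>

lemma double_series_remainder_bigo:
  fixes c :: "nat \<Rightarrow> nat \<Rightarrow> real" and a b t :: "'a \<Rightarrow> real"
  assumes f: "\<And>x y. \<bar>x\<bar> < e \<Longrightarrow> \<bar>y\<bar> < e \<Longrightarrow>
      ((\<lambda>(i, j). c i j * x ^ i * y ^ j) has_sum f x y) UNIV"
    and e: "e > 0" and a: "a \<in> O[F](t)" and b: "b \<in> O[F](t)" and t: "(t \<longlongrightarrow> 0) F"
  shows "(\<lambda>r. f (a r) (b r) - (\<Sum>(i, j)\<in>deg_lt N. c i j * a r ^ i * b r ^ j))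
    \<in> O[F](\<lambda>r. t r ^ N)"
proof -
  obtain C where C: "\<And>x y s. \<bar>x\<bar> \<le> s \<Longrightarrow> \<bar>y\<bar> \<le> s \<Longrightarrow> s \<le> e / 2 \<Longrightarrow>
      \<bar>f x y - (\<Sum>(i, j)\<in>deg_lt N. c i j * x ^ i * y ^ j)\<bar> \<le> C * s ^ N"
    by (rule double_series_remainder_le[OF f, where d = "e / 2" and N = N]) (use e in auto)
  from a obtain ka where ka: "\<forall>\<^sub>F r in F. norm (a r) \<le> ka * norm (t r)"
    by (auto elim: landau_o.bigE)
  from b obtain kb where kb: "\<forall>\<^sub>F r in F. norm (b r) \<le> kb * norm (t r)"
    by (auto elim: landau_o.bigE)
  \<comment> \<open>A common constant for both coordinates, so that the uniform estimate applies
    with \<open>s = k * \<bar>t r\<bar>\<close>.\<close>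
  define k where "k = max ka kb"
  have "((\<lambda>r. k * \<bar>t r\<bar>) \<longlongrightarrow> k * \<bar>0\<bar>) F"
    by (intro tendsto_intros t)
  then have "\<forall>\<^sub>F r in F. k * \<bar>t r\<bar> < e / 2"
    by (rule order_tendstoD) (use e in auto)
  then show ?thesis
    using ka kb
  proof (intro bigoI[of _ "C * k ^ N"], eventually_elim)
    case (elim r)
    have "\<bar>a r\<bar> \<le> k * \<bar>t r\<bar>" "\<bar>b r\<bar> \<le> k * \<bar>t r\<bar>"
      using elim mult_right_mono[of ka k "\<bar>t r\<bar>"] mult_right_mono[of kb k "\<bar>t r\<bar>"]
      by (auto simp: k_def)
    from C[OF this] elim show ?case
      by (simp add: power_mult_distrib power_abs mult_ac)
  qed
qed

text \<open>Truncation at degree 1 identifies the constant term, truncation at degree 2 the slope.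
  This links the linear coefficient to the partial derivative in the nondegeneracy
  condition.\<close>

lemma double_series_deriv:
  fixes c :: "nat \<Rightarrow> nat \<Rightarrow> real"
  assumes f: "\<And>x y. \<bar>x\<bar> < e \<Longrightarrow> \<bar>y\<bar> < e \<Longrightarrow>
      ((\<lambda>(i, j). c i j * x ^ i * y ^ j) has_sum f x y) UNIV"
    and e: "e > 0"
  shows "((\<lambda>x. f x 0) has_real_derivative c 1 0) (at 0)"
proof -
  have [simp]: "deg_lt (Suc 0) = {(0, 0)}" "deg_lt 2 = {(0, 0), (0, 1), (1, 0)}"
    by (auto simp: deg_lt_def)
  \<comment> \<open>The curve rests at the origin here; a constant that is O(x) must be 0.\<close>
  have "(\<lambda>_::real. f 0 0 - c 0 0) \<in> O[at 0](\<lambda>x. x ^ 1)"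
    using double_series_remainder_bigo[OF f e, of "\<lambda>_. 0" "at 0" "\<lambda>x. x" "\<lambda>_. 0" 1] by simp
  then have "(\<lambda>_::real. f 0 0 - c 0 0) \<in> o[at 0](\<lambda>_. 1)"
    by (rule landau_o.big_small_trans) (auto intro!: smalloI_tendsto tendsto_eq_intros)
  then have f0: "f 0 0 = c 0 0"
    using smalloD_tendsto[of "\<lambda>_. f 0 0 - c 0 0" "at (0::real)" "\<lambda>_. 1"]
    by (simp add: tendsto_const_iff)
  have "(\<lambda>x::real. f x 0 - (c 0 0 + c 1 0 * x)) \<in> O[at 0](\<lambda>x. x ^ 2)"
    using double_series_remainder_bigo[OF f e, of "\<lambda>x. x" "at 0" "\<lambda>x. x" "\<lambda>_. 0" 2] by simp
  also have "(\<lambda>x::real. x ^ 2) \<in> o[at 0](\<lambda>x. x)"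
    by (rule smalloI_tendsto)
      (auto intro!: tendsto_eq_intros simp: power2_eq_square eventually_at_filter)
  finally have "((\<lambda>x. (f x 0 - (c 0 0 + c 1 0 * x)) / x) \<longlongrightarrow> 0) (at 0)"
    by (rule smalloD_tendsto)
  then have "((\<lambda>x. (f x 0 - (c 0 0 + c 1 0 * x)) / x + c 1 0) \<longlongrightarrow> 0 + c 1 0) (at 0)"
    by (intro tendsto_intros)
  then have "((\<lambda>x. (f x 0 - f 0 0) / x) \<longlongrightarrow> c 1 0) (at 0)"
    unfolding add_0 by (rule Lim_transform_eventually)
      (auto simp: eventually_at_filter f0 field_simps)
  then show ?thesis
    by (simp add: has_field_derivative_iff)
qed

section \<open>The TOV equation as an identity of power series\<close>

text \<open>\<open>K\<close> represents 2M/r^3: a term r^k of the density, times r^2, integrates to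
  r^(k+3)/(k+3). After clearing denominators, one factor \<open>fps_X\<close> is pulled out and the
  other is paired with \<open>fps_deriv G\<close>, so that the bracket preserves parity.\<close>

lemma TOV_star_fps:
  assumes F: "\<mu> has_fps_expansion F" and G: "p has_fps_expansion G"
    and R: "R > 0" and TOV: "TOV_star R \<mu> p M"
  defines "K \<equiv> Abs_fps (\<lambda>k. fps_nth F k / real (k + 3))"
  shows "2 * fps_deriv G = fps_X * (2 * (K * (fps_X * fps_deriv G)) - (F + G) * (G + K))"
proof -
  define J where "J = fps_integral0 (F * fps_X\<^sup>2)"
  have J: "J = fps_X ^ 3 * K"
  proof (rule fps_ext)
    fix n
    show "fps_nth J n = fps_nth (fps_X ^ 3 * K) n"
    proof (cases n)
      case (Suc m)
      then show ?thesis
        by (auto simp: J_def K_def fps_X_power_mult_nth fps_X_power_mult_right_nth of_nat_diff divide_inverse mult.commute)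
    qed (simp add: J_def)
  qed
  have \<mu>2: "(\<lambda>x. \<mu> x * x\<^sup>2) has_fps_expansion F * fps_X\<^sup>2"
    by (intro fps_expansion_intros F)
  have "fps_conv_radius J > 0"
    using \<mu>2 fps_conv_radius_integral0[of "F * fps_X\<^sup>2"] order_less_le_trans
    unfolding J_def has_fps_expansion_def by blast
  \<comment> \<open>As a shift of \<open>J\<close>, the series \<open>K\<close> inherits a positive
    radius of convergence.\<close>
  moreover have "K = fps_shift 3 J"
    by (simp add: J mult.commute[of _ K] fps_shift_times_fps_X_power')
  ultimately have K: "fps_conv_radius K > 0"
    by simp
  then have Kexp: "eval_fps K has_fps_expansion K"
    by (rule eval_fps_has_fps_expansion)
  have "\<forall>\<^sub>F x in nhds (0::real). x \<in> eball 0 (fps_conv_radius K)"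
    using K by (intro eventually_nhds_in_open) (auto simp: zero_ereal_def)
  then have rad: "\<forall>\<^sub>F x in at_right (0::real). ereal \<bar>x\<bar> < fps_conv_radius K"
    unfolding eventually_at_filter by eventually_elim auto
  have int: "\<forall>\<^sub>F r in at_right 0. integral {0..r} (\<lambda>x. \<mu> x * x\<^sup>2) = eval_fps J r"
    unfolding J_def by (rule integral_eq_eval_fps_integral0[OF \<mu>2])
  have "\<forall>\<^sub>F r in at_right 0. r \<in> {0<..<R}"
    using R by (rule eventually_at_right_real)
  then have "\<forall>\<^sub>F r in at_right 0. 2 * (1 - r\<^sup>2 * eval_fps K r) * deriv p r
      + r * ((\<mu> r + p r) * (p r + eval_fps K r)) = 0"
    using int rad
  proof eventually_elim
    case (elim r)
    define k where "k = eval_fps K r"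
    have "M r = 1 / 2 * integral {0..r} (\<lambda>x. \<mu> x * x\<^sup>2)"
      using TOV elim(1) by (simp add: TOV_star_def)
    then have "2 * M r = integral {0..r} (\<lambda>x. \<mu> x * x\<^sup>2)"
      by linarith
    also have "\<dots> = r ^ 3 * k"
      using elim by (simp add: J eval_fps_mult k_def)
    finally have M: "2 * M r = r ^ 3 * k" .
    then have r2M: "r - 2 * M r = r * (1 - r\<^sup>2 * k)"
      by (simp add: algebra_simps power2_eq_square power3_eq_cube)
    \<comment> \<open>The absence of a horizon keeps the TOV denominator away from zero, so it can
      be cleared.\<close>
    have "r - 2 * M r > 0"
      using TOV elim by (auto simp: TOV_star_def)
    with elim have pos: "1 - r\<^sup>2 * k > 0"
      unfolding r2M by (simp add: zero_less_mult_iff)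
    have "(p has_real_derivative
        - (r\<^sup>2 * (\<mu> r + p r)) / (2 * (r - 2 * M r)) * (p r + 2 * M r / r ^ 3)) (at r)"
      using TOV elim by (auto simp: TOV_star_def)
    then have "deriv p r = - (r\<^sup>2 * (\<mu> r + p r)) / (2 * (r - 2 * M r)) * (p r + 2 * M r / r ^ 3)"
      by (rule DERIV_imp_deriv)
    also have "\<dots> = - (r * ((\<mu> r + p r) * (p r + k))) / (2 * (1 - r\<^sup>2 * k))"
    proof -
      have "2 * M r / r ^ 3 = k"
        unfolding M using elim by simp
      then show ?thesis
        unfolding r2M using elim pos by (simp add: divide_simps power2_eq_square)
    qed
    finally show ?case
      unfolding k_def[symmetric] using pos by (simp add: divide_simps mult.commute[of "deriv p r"])
  qed
  then have "2 * (1 - fps_X\<^sup>2 * K) * fps_deriv G + fps_X * ((F + G) * (G + K)) = 0"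
    by (rule fps_eq_0_if_eventually_0_at_right[rotated]) (intro fps_expansion_intros F G Kexp)
  then show ?thesis
    by (simp add: algebra_simps power2_eq_square add_eq_0_iff2)
qed

text \<open>Compare coefficients of order \<open>n - 1\<close>: the left side gives
  \<open>2 * n\<close> times the \<open>n\<close>-th coefficient of \<open>G\<close>; the right side
  gives coefficient \<open>n - 2\<close> of \<open>L\<close>, which is odd and below
  \<open>n\<close>, or 0 if \<open>n = 1\<close>.\<close>

lemma TOV_star_fps_nth_pressure:
  assumes "\<mu> has_fps_expansion F" "p has_fps_expansion G" "R > 0" "TOV_star R \<mu> p M"
    and F: "even_below n F" and G: "even_below n G" and n: "odd n"
  shows "fps_nth G n = 0"
proof -
  define K where "K = Abs_fps (\<lambda>k. fps_nth F k / real (k + 3))"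
  define L where "L = 2 * (K * (fps_X * fps_deriv G)) - (F + G) * (G + K)"
  have K: "even_below n K"
    using F by (simp add: even_below_def K_def)
  \<comment> \<open>Its \<open>k\<close>-th coefficient is \<open>k\<close> times that of
    \<open>G\<close>, so parity survives, unlike for \<open>fps_deriv G\<close> alone.\<close>
  have "even_below n (fps_X * fps_deriv G)"
    using G by (auto simp: even_below_def fps_X_mult_nth)
  then have L: "even_below n L"
    unfolding L_def mult_2 using F G K
    by (intro even_below_diff even_below_add even_below_mult[OF K] even_below_mult[of n "F + G"])
  have "2 * fps_deriv G = fps_X * L"
    unfolding L_def K_def by (rule TOV_star_fps) fact+
  then have "fps_nth (2 * fps_deriv G) (n - 1) = fps_nth (fps_X * L) (n - 1)"
    by simp
  moreover have "fps_nth (2 * fps_deriv G) (n - 1) = 2 * real n * fps_nth G n"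
    using odd_pos[OF n] by (simp add: numeral_fps_const)
  moreover have "fps_nth (fps_X * L) (n - 1) = 0"
    using L n by (auto simp: even_below_def fps_X_mult_nth)
  ultimately show ?thesis
    using odd_pos[OF n] by simp
qed

section \<open>The equation of state at an odd order\<close>

lemma equation_of_state_fps_nth_density:
  fixes f :: "real \<Rightarrow> real \<Rightarrow> real" and \<mu> p :: "real \<Rightarrow> real"
  assumes f: "real_analytic2_at f (\<mu> 0) (p 0)" and df: "deriv (\<lambda>m. f m (p 0)) (\<mu> 0) \<noteq> 0"
    and F: "\<mu> has_fps_expansion F" and G: "p has_fps_expansion G"
    and R: "R > 0" and eos: "\<And>r. 0 \<le> r \<Longrightarrow> r < R \<Longrightarrow> f (\<mu> r) (p r) = 0"
    and even: "even_below n F" "even_below n G" and n: "odd n" and Gn: "fps_nth G n = 0"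
  shows "fps_nth F n = 0"
proof -
  obtain c e where e: "e > 0" and ce: "\<And>x y. \<bar>x - \<mu> 0\<bar> < e \<Longrightarrow> \<bar>y - p 0\<bar> < e \<Longrightarrow>
      ((\<lambda>(i, j). c i j * (x - \<mu> 0) ^ i * (y - p 0) ^ j) has_sum f x y) UNIV"
    using f unfolding real_analytic2_at_def by blast
  define g where "g x y = f (\<mu> 0 + x) (p 0 + y)" for x y
  have g: "((\<lambda>(i, j). c i j * x ^ i * y ^ j) has_sum g x y) UNIV" if "\<bar>x\<bar> < e" "\<bar>y\<bar> < e" for x y
    using ce[of "\<mu> 0 + x" "p 0 + y"] that by (simp add: g_def)
  have "((\<lambda>x. f (x + \<mu> 0) (p 0)) has_real_derivative c 1 0) (at 0)"
    using double_series_deriv[OF g e] by (simp add: g_def add.commute)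
  then have "((\<lambda>m. f m (p 0)) has_real_derivative c 1 0) (at (\<mu> 0))"
    using DERIV_shift[of "\<lambda>m. f m (p 0)" "c 1 0" 0 "\<mu> 0"] by (simp add: add.commute)
  \<comment> \<open>The derivative exists and equals \<open>c 1 0\<close>, so the condition on
    \<open>deriv\<close> speaks about this coefficient.\<close>
  with df have c10: "c 1 0 \<noteq> 0"
    by (auto dest: DERIV_imp_deriv)

  define A where "A = F - fps_const (\<mu> 0)"
  define B where "B = G - fps_const (p 0)"
  \<comment> \<open>\<open>Suc n\<close> keeps the degrees up to \<open>n\<close>; the discarded
    part is O(r^(n+1)) and cannot affect coefficient \<open>n\<close>.\<close>
  define H where "H = (\<Sum>(i, j)\<in>deg_lt (Suc n). fps_const (c i j) * A ^ i * B ^ j)"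
  have A: "(\<lambda>r. \<mu> r - \<mu> 0) has_fps_expansion A" and B: "(\<lambda>r. p r - p 0) has_fps_expansion B"
    unfolding A_def B_def by (intro fps_expansion_intros F G)+
  have F0: "fps_nth F 0 = \<mu> 0" and G0: "fps_nth G 0 = p 0"
    using F G by (auto simp: has_fps_expansion_def eval_fps_at_0 dest!: eventually_nhds_x_imp_x)

  have bigo: "(\<lambda>r. g (\<mu> r - \<mu> 0) (p r - p 0)
      - (\<Sum>(i, j)\<in>deg_lt (Suc n). c i j * (\<mu> r - \<mu> 0) ^ i * (p r - p 0) ^ j))
      \<in> O[at_right 0](\<lambda>r. r ^ Suc n)"
  proof (rule double_series_remainder_bigo[OF g e])
    show "(\<lambda>r. \<mu> r - \<mu> 0) \<in> O[at_right 0](\<lambda>r. r)" "(\<lambda>r. p r - p 0) \<in> O[at_right 0](\<lambda>r. r)"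
      by (rule landau_o.big.filter_mono[OF at_le[OF subset_UNIV]], rule has_fps_expansion_bigo_id, fact)+
  qed (simp_all add: tendsto_ident_at)
  have "\<forall>\<^sub>F r in at_right 0. r \<in> {0<..<R}"
    using R by (rule eventually_at_right_real)
  \<comment> \<open>Since \<open>g\<close> vanishes along the star, the remainder is minus the
    truncated polynomial, which thereby inherits the bound.\<close>
  then have ev: "\<forall>\<^sub>F r in at_right 0. g (\<mu> r - \<mu> 0) (p r - p 0)
      - (\<Sum>(i, j)\<in>deg_lt (Suc n). c i j * (\<mu> r - \<mu> 0) ^ i * (p r - p 0) ^ j)
      = - (\<Sum>(i, j)\<in>deg_lt (Suc n). c i j * (\<mu> r - \<mu> 0) ^ i * (p r - p 0) ^ j)"
    by eventually_elim (simp add: g_def eos)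
  have H_bigo: "(\<lambda>r. \<Sum>(i, j)\<in>deg_lt (Suc n). c i j * (\<mu> r - \<mu> 0) ^ i * (p r - p 0) ^ j)
      \<in> O[at_right 0](\<lambda>r. r ^ Suc n)"
    using iffD1[OF landau_o.big.in_cong[OF ev] bigo] by simp
  have H: "(\<lambda>r. \<Sum>(i, j)\<in>deg_lt (Suc n). c i j * (\<mu> r - \<mu> 0) ^ i * (p r - p 0) ^ j)
      has_fps_expansion H"
    unfolding H_def case_prod_beta by (intro fps_expansion_intros A B)
  have "fps_nth H n = 0"
    by (rule fps_nth_eq_0_if_bigo_at_right[OF H H_bigo]) simp

  moreover have "fps_nth H n = c 1 0 * fps_nth F n"
  proof -
    have A': "even_below n A" "fps_nth A 0 = 0" and B': "even_below n B" "fps_nth B 0 = 0"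
      unfolding A_def B_def using even by (auto intro!: even_below_diff simp: F0 G0)
    have Bn: "fps_nth B n = 0"
      using odd_pos[OF n] Gn by (simp add: B_def)
    have "fps_nth H n = (\<Sum>z\<in>deg_lt (Suc n).
        case z of (i, j) \<Rightarrow> c i j * fps_nth (A ^ i * B ^ j) n)"
      by (simp add: H_def fps_sum_nth case_prod_beta mult.assoc)
    \<comment> \<open>The other linear monomial, \<open>(0, 1)\<close>, contributes the
      \<open>n\<close>-th pressure coefficient, already known to be 0.\<close>
    also have "\<dots> = (\<Sum>z\<in>{(1, 0)}. case z of (i, j) \<Rightarrow> c i j * fps_nth (A ^ i * B ^ j) n)"
    proof (rule sum.mono_neutral_right)
      show "\<forall>z\<in>deg_lt (Suc n) - {(1, 0)}.
          (case z of (i, j) \<Rightarrow> c i j * fps_nth (A ^ i * B ^ j) n) = 0"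
      proof
        fix z assume z: "z \<in> deg_lt (Suc n) - {(1, 0)}"
        obtain i j where ij: "z = (i, j)"
          by fastforce
        show "(case z of (i, j) \<Rightarrow> c i j * fps_nth (A ^ i * B ^ j) n) = 0"
        proof (cases "(i, j) = (0, 1)")
          case False
          with z ij even_below_monom_nth[OF A' B' n, of i j] show ?thesis
            by simp
        qed (use ij Bn in simp)
      qed
    qed (use odd_pos[OF n] in simp_all)
    also have "\<dots> = c 1 0 * fps_nth F n"
      using odd_pos[OF n] by (simp add: A_def)
    finally show ?thesis .
  qed
  ultimately show ?thesis
    using c10 by simp
qed

section \<open>Induction over the odd orders\<close>

theorem theorem1:
  fixes f :: "real \<Rightarrow> real \<Rightarrow> real"
    and \<mu> p M :: "real \<Rightarrow> real"
    and R :: real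
    and F G :: "real fps"
  assumes "real_analytic2_at f (\<mu> 0) (p 0)"
    and "deriv (\<lambda>m. f m (p 0)) (\<mu> 0) \<noteq> 0"
    and "\<mu> has_fps_expansion F"
    and "p has_fps_expansion G"
    and "R > 0"
    and "TOV_star R \<mu> p M"
    and "\<And>r. 0 \<le> r \<Longrightarrow> r < R \<Longrightarrow> f (\<mu> r) (p r) = 0"
  shows "(\<forall>n. odd n \<longrightarrow> fps_nth F n = 0) \<and> (\<forall>\<^sub>F r in nhds 0. \<mu> (- r) = \<mu> r)"
proof
  \<comment> \<open>Density and pressure are carried together: at each odd order the TOV equation
    settles the pressure first, then the equation of state the density, both from the lower orders
    of both series.\<close>
  have "odd n \<longrightarrow> fps_nth F n = 0 \<and> fps_nth G n = 0" for n
  proof (induction n rule: less_induct)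
    case (less n)
    then have even: "even_below n F" "even_below n G"
      by (auto simp: even_below_def)
    show ?case
    proof
      assume n: "odd n"
      have "fps_nth G n = 0"
        by (rule TOV_star_fps_nth_pressure[OF assms(3-6) even n])
      with equation_of_state_fps_nth_density[OF assms(1-5,7) even n this]
      show "fps_nth F n = 0 \<and> fps_nth G n = 0"
        by simp
    qed
  qed
  then show odd: "\<forall>n. odd n \<longrightarrow> fps_nth F n = 0"
    by simp
  \<comment> \<open>The two series agree term by term, so their \<open>suminf\<close> values
    coincide at every \<open>r\<close>, even outside the disc of convergence.\<close>
  have eval_even: "eval_fps F (- r) = eval_fps F r" for r
    unfolding eval_fps_def
  proof (rule suminf_cong)
    fix n show "fps_nth F n * (- r) ^ n = fps_nth F n * r ^ n"
      using odd by (cases "even n") auto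
  qed
  have ev: "\<forall>\<^sub>F r in nhds 0. eval_fps F r = \<mu> r"
    using assms(3) by (simp add: has_fps_expansion_def)
  \<comment> \<open>Reflection preserves neighbourhoods of 0, and the expansion of the density holds
    on both sides of 0.\<close>
  have "filterlim uminus (nhds 0) (nhds (0::real))"
    using tendsto_minus[OF filterlim_ident, of "0::real"] by simp
  with ev have "\<forall>\<^sub>F r in nhds 0. eval_fps F (- r) = \<mu> (- r)"
    by (rule eventually_compose_filterlim)
  with ev show "\<forall>\<^sub>F r in nhds 0. \<mu> (- r) = \<mu> r"
    by eventually_elim (simp add: eval_even)
qed

end
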